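(* Consider, for each $K\ge 1$, a binary-symmetric parallel-relay (BSPR) network with $K$ relays and cross-over probabilities $p_{s,i},p_{i,d}\in[0,\tfrac12]$ (which may depend on $K$), and put $p_i=p_{s,i}(1-p_{i,d})+(1-p_{s,i})p_{i,d}$ for $i\in\{1,\dots,K\}$. Uncoded transmission at the source and forwarding relays are used. For a nonempty subset $\mathcal M\subseteq\{1,\dots,K\}$ let $p_{\mathrm{MAX}(\mathcal M)}=\max_{m\in\mathcal M}p_m$. If for each $K$ there exists a nonempty $\mathcal M=\mathcal M_K\subseteq\{1,\dots,K\}$ such that $$|\mathcal M_K|\Big(\tfrac12-p_{\mathrm{MAX}(\mathcal M_K)}\Big)^2\to\infty\quad\text{as } K\to\infty,$$ then the asymptotic capacity of $1$ bit per channel use is achievable with a sufficiently large number of relays. That is: for every $\epsilon>0$ there is $K_0$ such that for every $K\ge K_0$ there is a (possibly randomized) decoding rule producing $\hat W\in\{0,1\}$ from $(Y_1,\dots,Y_K)$ with $$\Pr\{\hat W\ne W\}<\epsilon ,$$ where $W$ is the source bit, uniform on $\{0,1\}$, sent uncoded (one new bit per channel use, i.e. at rate $1$), and $Y_1,\dots,Y_K$ are the destination's received signals corresponding to that bit.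
   Context: **The BSPR network.** There is one source, $K$ relays $1,\dots,K$, and one destination. All variables are binary, and $\oplus$ is addition modulo 2. At each time $t$ the source transmits $U[t]$ and relay $i$ receives $V_i[t]=U[t]\oplus Z_i[t]$ with $\Pr\{Z_i[t]=1\}=p_{s,i}$; relay $i$ transmits $X_i[t]$ and the destination receives, on a separate link for each $i$, $Y_i[t]=X_i[t]\oplus E_i[t]$ with $\Pr\{E_i[t]=1\}=p_{i,d}$. All the noises $Z_i[t],E_i[t]$ are independent of each other and of the source bits. **Forwarding relays.** Relay $i$ is a forwarding relay if $X_i[t]=V_i[t-1]$ for all $t$. **Uncoded transmission.** The source sends its uniformly distributed message bits directly, $U=W$, one fresh bit per channel use (rate 1). With forwarding relays, dropping time indices, the signals received by the destination for the bit $W$ are $Y_i=W\oplus Z_i\oplus E_i$, $i=1,\dots,K$, with $\Pr\{Z_i\oplus E_i=1\}=p_i$. The value $1$ bit per channel use is an upper bound on the capacity of the network for every $K$, since the source input is binary; "the asymptotic capacity of 1 bit per channel use is achievable with a sufficiently large number of relays" means that at rate $1$ the error probability of the source bit can be made smaller than any $\epsilon>0$ for all sufficiently large $K$. *)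

theory Defs
  imports "HOL-Probability.Probability" "HOL-Library.Z2"
begin

text \<open>
  Binary signals take values in the two-element field \<^typ>\<open>bit\<close>, whose addition is
  addition modulo 2. A signal is a family of random variables on \<open>M\<close> indexed by the relay
  \<open>i \<in> {1..K}\<close> (where applicable) and the discrete time \<open>t\<close>, which starts at 0.
\<close>

definition relay_noises ::
    "(nat \<Rightarrow> nat \<Rightarrow> 'a \<Rightarrow> bit) \<Rightarrow> (nat \<Rightarrow> nat \<Rightarrow> 'a \<Rightarrow> bit) \<Rightarrow> (nat \<times> nat) + (nat \<times> nat) \<Rightarrow> 'a \<Rightarrow> bit"
  where "relay_noises Z E = case_sum (\<lambda>(i, t). Z i t) (\<lambda>(i, t). E i t)"

definition relay_noise_index :: "nat \<Rightarrow> ((nat \<times> nat) + (nat \<times> nat)) set"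
  where "relay_noise_index K = ({1..K} \<times> UNIV) <+> ({1..K} \<times> UNIV)"

text \<open>
  The last assumption says that the sigma-algebra generated by the whole source process is
  independent of the one generated by the whole noise process; it does not constrain the dependence of the source bits among each other. The relay
  outputs \<open>X\<close> are left open here and are determined by the relaying scheme.
\<close>

locale bspr_network = prob_space M
  for M :: "'a measure" +
  fixes K :: nat
    and p_s p_d :: "nat \<Rightarrow> real"
    and U :: "nat \<Rightarrow> 'a \<Rightarrow> bit"
    and Z V X E Y :: "nat \<Rightarrow> nat \<Rightarrow> 'a \<Rightarrow> bit"
  assumes relay_received:
      "\<And>i t \<omega>. i \<in> {1..K} \<Longrightarrow> \<omega> \<in> space M \<Longrightarrow> V i t \<omega> = U t \<omega> + Z i t \<omega>"
    and destination_received: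
      "\<And>i t \<omega>. i \<in> {1..K} \<Longrightarrow> \<omega> \<in> space M \<Longrightarrow> Y i t \<omega> = X i t \<omega> + E i t \<omega>"
    and source_relay_crossover:
      "\<And>i t. i \<in> {1..K} \<Longrightarrow> prob {\<omega> \<in> space M. Z i t \<omega> = 1} = p_s i"
    and relay_destination_crossover:
      "\<And>i t. i \<in> {1..K} \<Longrightarrow> prob {\<omega> \<in> space M. E i t \<omega> = 1} = p_d i"
    and noises_independent:
      "indep_vars (\<lambda>_. count_space UNIV) (relay_noises Z E) (relay_noise_index K)"
    and source_random_variable:
      "\<And>t. random_variable (count_space UNIV) (U t)"
    and source_independent_of_noises:
      "indep_set
         (sets (vimage_algebra (space M) (\<lambda>\<omega> t. U t \<omega>)
           (\<Pi>\<^sub>M t\<in>UNIV. count_space UNIV)))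
         (sets (vimage_algebra (space M)
           (\<lambda>\<omega>. \<lambda>j\<in>relay_noise_index K. relay_noises Z E j \<omega>)
           (\<Pi>\<^sub>M j\<in>relay_noise_index K. count_space UNIV)))"

text \<open>The output of a forwarding relay at the initial time is unconstrained.\<close>

definition forwarding_relay ::
    "'a measure \<Rightarrow> (nat \<Rightarrow> 'a \<Rightarrow> bit) \<Rightarrow> (nat \<Rightarrow> 'a \<Rightarrow> bit) \<Rightarrow> bool"
  where "forwarding_relay M V X \<longleftrightarrow> (\<forall>t\<ge>1. \<forall>\<omega>\<in>space M. X t \<omega> = V (t - 1) \<omega>)"

definition uncoded_transmission ::
    "'a measure \<Rightarrow> (nat \<Rightarrow> 'a \<Rightarrow> bit) \<Rightarrow> (nat \<Rightarrow> 'a \<Rightarrow> bit) \<Rightarrow> bool"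
  where "uncoded_transmission M W U \<longleftrightarrow>
    prob_space.indep_vars M (\<lambda>_. count_space UNIV) W UNIV \<and>
    (\<forall>t. measure M {\<omega> \<in> space M. W t \<omega> = 1} = 1 / 2) \<and>
    (\<forall>t. \<forall>\<omega>\<in>space M. U t \<omega> = W t \<omega>)"

definition crossover :: "real \<Rightarrow> real \<Rightarrow> real"
  where "crossover a b = a * (1 - b) + (1 - a) * b"

text \<open>
  A randomized decoding rule assigns to the received vector \<open>(y 1, \<dots>, y K)\<close> the distribution of
  the estimate; deterministic rules are those with values of the form \<^term>\<open>return_pmf b\<close>.
  Conditionally on the received vector the estimate is independent of everything else, hence
  the probability of a wrong estimate is the expectation below.
\<close>

definition decoding_error_prob ::
    "'a measure \<Rightarrow> nat \<Rightarrow> ('a \<Rightarrow> bit) \<Rightarrow> (nat \<Rightarrow> 'a \<Rightarrow> bit) \<Rightarrow> ((nat \<Rightarrow> bit) \<Rightarrow> bit pmf) \<Rightarrow> real"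
  where "decoding_error_prob M K w y dec =
    (\<integral>\<omega>. measure_pmf.prob (dec (\<lambda>i\<in>{1..K}. y i \<omega>)) {b. b \<noteq> w \<omega>} \<partial>M)"

end

theory Submission
  imports Defs
begin

text \<open>
  The destination decodes by majority vote over the relays in \<open>S\<close>. Along relay \<open>i\<close> the source bit
  is flipped by the noise \<open>Z i t + E i (t + 1)\<close>; these noises are independent across relays and equal
  1 with probability \<open>p i\<close>. A wrong decision forces at least half of them to be 1, although
  their expected number falls short of half by at least \<open>card S * (1/2 - Max (p ` S))\<close>. By Hoeffding's
  inequality this has probability at most \<open>exp (- 2 * card S * (1/2 - Max (p ` S))\<^sup>2)\<close>.
\<close>

section \<open>Sums of independent bits\<close>

lemma half_minus_crossover: "1 / 2 - crossover a b = 2 * (1 / 2 - a) * (1 / 2 - b)"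
  by (simp add: crossover_def field_simps)

text \<open>In terms of the biases \<open>1 - 2 * a\<close> and \<open>1 - 2 * b\<close>, two
  channels in series have the product as bias, and a product of nonnegative biases is
  nonnegative.\<close>

lemma crossover_le_half:
  assumes "a \<le> 1 / 2" "b \<le> 1 / 2"
  shows "crossover a b \<le> 1 / 2"
proof -
  have "0 \<le> 2 * (1 / 2 - a) * (1 / 2 - b)"
    using assms by simp
  then show ?thesis
    unfolding half_minus_crossover[symmetric] by simp
qed

lemma (in prob_space) indep_vars_imp_indep_var:
  assumes "indep_vars N X I" "i \<in> I" "j \<in> I" "i \<noteq> j"
  shows "indep_var (N i) (X i) (N j) (X j)"
proof -
  have "indep_var (PiM {i} N) (\<lambda>\<omega>. restrict (\<lambda>k. X k \<omega>) {i})
      (PiM {j} N) (\<lambda>\<omega>. restrict (\<lambda>k. X k \<omega>) {j})"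
    using assms by (intro indep_var_restrict[where I = I]) auto
  from indep_var_compose[OF this, of "\<lambda>x. x i" "N i" "\<lambda>x. x j" "N j"] show ?thesis
    by (simp add: comp_def measurable_component_singleton)
qed

lemma (in prob_space) prob_add_bit:
  fixes A B :: "'a \<Rightarrow> bit"
  assumes "indep_var (count_space UNIV) A (count_space UNIV) B"
  shows "prob {\<omega> \<in> space M. A \<omega> + B \<omega> = 1} =
    crossover (prob {\<omega> \<in> space M. A \<omega> = 1}) (prob {\<omega> \<in> space M. B \<omega> = 1})"
proof -
  let ?A = "{\<omega> \<in> space M. A \<omega> = 1}" and ?B = "{\<omega> \<in> space M. B \<omega> = 1}"
  have [measurable]: "A \<in> measurable M (count_space UNIV)" "B \<in> measurable M (count_space UNIV)"
    using assms by (auto dest: indep_var_rv1 indep_var_rv2)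
  have events: "?A \<in> events" "?B \<in> events"
    by measurable
  have "prob ((\<lambda>\<omega>. (A \<omega>, B \<omega>)) -` ({1} \<times> {1}) \<inter> space M) =
      prob (A -` {1} \<inter> space M) * prob (B -` {1} \<inter> space M)"
    using assms by (rule indep_varD) auto
  moreover have "(\<lambda>\<omega>. (A \<omega>, B \<omega>)) -` ({1} \<times> {1}) \<inter> space M = ?A \<inter> ?B"
    "A -` {1} \<inter> space M = ?A" "B -` {1} \<inter> space M = ?B"
    by auto
  ultimately have prod: "prob (?A \<inter> ?B) = prob ?A * prob ?B"
    by simp
  \<comment> \<open>Modulo 2 the sum is 1 exactly when one summand is 1 and the other is
    not.\<close>
  have "{\<omega> \<in> space M. A \<omega> + B \<omega> = 1} = (?A - ?A \<inter> ?B) \<union> (?B - ?A \<inter> ?B)"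
    by auto
  then have "prob {\<omega> \<in> space M. A \<omega> + B \<omega> = 1} = prob (?A - ?A \<inter> ?B) + prob (?B - ?A \<inter> ?B)"
    using events by (simp only:) (intro finite_measure_Union; auto)
  also have "\<dots> = (prob ?A - prob (?A \<inter> ?B)) + (prob ?B - prob (?A \<inter> ?B))"
    using finite_measure_Diff[of ?A "?A \<inter> ?B"] finite_measure_Diff[of ?B "?A \<inter> ?B"] events
    by (simp only: sets.Int inf_le1 inf_le2)
  finally show ?thesis
    unfolding prod by (simp only: crossover_def algebra_simps)
qed

lemma measurable_add_bit:
  fixes f g :: "'a \<Rightarrow> bit"
  assumes "f \<in> measurable M (count_space UNIV)" "g \<in> measurable M (count_space UNIV)"
  shows "(\<lambda>x. f x + g x) \<in> measurable M (count_space UNIV)"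
\<comment> \<open>Since \<open>f\<close> takes only countably many values, it suffices to treat it
  as a constant \<open>b\<close>.\<close>
proof (rule measurable_compose_countable'[OF _ assms(1)])
  show "countable (UNIV :: bit set)"
    by (rule countable_subset[of _ "{0, 1}"]) auto
  show "(\<lambda>x. b + g x) \<in> measurable M (count_space UNIV)" for b
    using assms(2) by (rule measurable_compose) simp
qed

section \<open>Majority vote\<close>

definition majority :: "nat set \<Rightarrow> (nat \<Rightarrow> bit) \<Rightarrow> bit"
  where "majority S y = of_bool (card S < 2 * card {i \<in> S. y i = 1})"

text \<open>The bound mentions the noise alone, so one event covers both values of the source bit.
  If \<open>w = 0\<close>, the received ones are the flips, and an error means that they exceed
  half. If \<open>w = 1\<close>, they are the complement of the flips, and an error means that they
  are at most half. A tie is decoded as 0, which is why the inequality is not strict.\<close>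

lemma majority_wrong:
  assumes "finite S" and y: "\<And>i. i \<in> S \<Longrightarrow> y i = w + n i" and wrong: "majority S y \<noteq> w"
  shows "card S \<le> 2 * card {i \<in> S. n i = 1}"
proof (cases "w = 0")
  case True
  then have "{i \<in> S. y i = 1} = {i \<in> S. n i = 1}"
    using y by auto
  then show ?thesis
    using wrong True by (auto simp: majority_def split: if_splits)
next
  case False
  then have w: "w = 1"
    by simp
  then have "{i \<in> S. y i = 1} = S - {i \<in> S. n i = 1}"
    using y by auto
  then have "card {i \<in> S. y i = 1} = card S - card {i \<in> S. n i = 1}"
    using \<open>finite S\<close> by (simp add: card_Diff_subset)
  moreover have "2 * card {i \<in> S. y i = 1} \<le> card S"
    using wrong w by (auto simp: majority_def split: if_splits)
  ultimately show ?thesis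
    by linarith
qed

section \<open>Noise along the relay paths\<close>

context bspr_network
begin

lemma crossover_path_noise:
  assumes i: "i \<in> {1..K}"
  shows "prob {\<omega> \<in> space M. Z i t \<omega> + E i (t + 1) \<omega> = 1} = crossover (p_s i) (p_d i)"
proof -
  have "indep_var (count_space UNIV) (relay_noises Z E (Inl (i, t)))
      (count_space UNIV) (relay_noises Z E (Inr (i, t + 1)))"
    by (rule indep_vars_imp_indep_var[OF noises_independent])
      (use i in \<open>auto simp: relay_noise_index_def\<close>)
  then have "indep_var (count_space UNIV) (Z i t) (count_space UNIV) (E i (t + 1))"
    by (simp add: relay_noises_def)
  from prob_add_bit[OF this] show ?thesis
    using i by (simp add: source_relay_crossover relay_destination_crossover)
qed

lemma indep_vars_path_noise:
  assumes S: "S \<subseteq> {1..K}"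
  shows "indep_vars (\<lambda>_. count_space UNIV) (\<lambda>i \<omega>. Z i t \<omega> + E i (t + 1) \<omega>) S"
proof -
  \<comment> \<open>\<open>J i\<close> holds the two noises that the bit sent at time
    \<open>t\<close> meets on its way through relay \<open>i\<close>, the second one step later
    because of the relay's delay. These blocks are disjoint for distinct \<open>i\<close>, so
    functions of them are independent.\<close>
  define J where "J i = {Inl (i, t), Inr (i, t + 1)}" for i :: nat
  have "indep_vars (\<lambda>i. PiM (J i) (\<lambda>_. count_space UNIV))
      (\<lambda>i \<omega>. restrict (\<lambda>j. relay_noises Z E j \<omega>) (J i)) S"
    using noises_independent
    by (rule indep_vars_restrict)
      (use S in \<open>auto simp: J_def relay_noise_index_def disjoint_family_on_def\<close>)
  then have "indep_vars (\<lambda>_. count_space UNIV)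
      (\<lambda>i \<omega>. (\<lambda>x. x (Inl (i, t)) + x (Inr (i, t + 1)))
        (restrict (\<lambda>j. relay_noises Z E j \<omega>) (J i))) S"
  proof (rule indep_vars_compose2[where Y = "\<lambda>i x. x (Inl (i, t)) + x (Inr (i, t + 1))"])
    show "(\<lambda>x. x (Inl (i, t)) + x (Inr (i, t + 1)))
        \<in> measurable (PiM (J i) (\<lambda>_. count_space UNIV :: bit measure)) (count_space UNIV)" for i
      by (intro measurable_add_bit measurable_component_singleton) (simp_all only: J_def insert_iff simp_thms)
  qed
  then show ?thesis
    by (simp add: J_def relay_noises_def)
qed

lemma prob_half_path_noises_le:
  assumes S: "S \<subseteq> {1..K}" "S \<noteq> {}"
    and q: "\<And>i. i \<in> S \<Longrightarrow> crossover (p_s i) (p_d i) \<le> q" "q \<le> 1 / 2"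
  shows "prob {\<omega> \<in> space M. card S \<le> 2 * card {i \<in> S. Z i t \<omega> + E i (t + 1) \<omega> = 1}}
    \<le> exp (- 2 * (card S * (1 / 2 - q)\<^sup>2))"
proof -
  \<comment> \<open>Hoeffding's inequality concerns bounded real variables, so the flips are recoded
    as reals in [0, 1].\<close>
  define N :: "nat \<Rightarrow> 'a \<Rightarrow> real"
    where "N i \<omega> = of_bool (Z i t \<omega> + E i (t + 1) \<omega> = 1)" for i \<omega>
  have "finite S"
    using S finite_subset by blast
  have "indep_vars (\<lambda>_. borel) N S"
    unfolding N_def using indep_vars_path_noise[OF S(1)]
    by (rule indep_vars_compose2) simp
  then interpret Hoeffding_ineq M S N "\<lambda>_. 0" "\<lambda>_. 1" "\<Sum>i\<in>S. expectation (N i)"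
    by unfold_locales (use \<open>finite S\<close> in \<open>auto simp: N_def\<close>)
  let ?mu = "\<Sum>i\<in>S. expectation (N i)"
  have "expectation (N i) = crossover (p_s i) (p_d i)" if i: "i \<in> S" for i
  proof -
    have "expectation (N i) = expectation (indicator {\<omega> \<in> space M. Z i t \<omega> + E i (t + 1) \<omega> = 1})"
      by (rule Bochner_Integration.integral_cong) (auto simp: N_def indicator_def)
    also have "\<dots> = prob {\<omega> \<in> space M. Z i t \<omega> + E i (t + 1) \<omega> = 1}"
      by (auto intro: arg_cong[where f = prob])
    finally show ?thesis
      using crossover_path_noise i S by auto
  qed
  then have "?mu \<le> card S * q"
    using q by (intro order.trans[OF sum_bounded_above[where K = q]]) auto
  \<comment> \<open>The excess over the mean that at least half the paths must reach if they flip
    the bit. That its lower bound is nonnegative both admits Hoeffding's inequality and lets the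
    estimate be squared.\<close>
  then have gap: "card S * (1 / 2 - q) \<le> card S / 2 - ?mu"
    by (simp add: algebra_simps)
  have gap_nonneg: "0 \<le> card S * (1 / 2 - q)"
    using q by simp
  have card_pos: "0 < card S"
    using \<open>finite S\<close> S by (simp add: card_gt_0_iff)
  have sum_N: "(\<Sum>i\<in>S. N i \<omega>) = card {i \<in> S. Z i t \<omega> + E i (t + 1) \<omega> = 1}" for \<omega>
    using \<open>finite S\<close> by (simp add: N_def sum.If_cases of_bool_def Int_def)
  have "prob {\<omega> \<in> space M. card S \<le> 2 * card {i \<in> S. Z i t \<omega> + E i (t + 1) \<omega> = 1}} =
      prob {\<omega> \<in> space M. ?mu + (card S / 2 - ?mu) \<le> (\<Sum>i\<in>S. N i \<omega>)}"
    unfolding sum_N by (rule arg_cong[where f = prob], rule Collect_cong) linarith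
  \<comment> \<open>All ranges have length 1, so the denominator is \<open>card S\<close>; it is
    positive because \<open>S\<close> is nonempty.\<close>
  also have "\<dots> \<le> exp (- 2 * (card S / 2 - ?mu)\<^sup>2 / (\<Sum>i\<in>S. (1 - 0)\<^sup>2))"
    using gap gap_nonneg card_pos by (intro Hoeffding_ineq_ge) auto
  also have "\<dots> \<le> exp (- 2 * (card S * (1 / 2 - q))\<^sup>2 / card S)"
    using power_mono[OF gap gap_nonneg, of 2] by (simp add: divide_right_mono)
  also have "- 2 * (card S * (1 / 2 - q))\<^sup>2 / card S = - 2 * (card S * (1 / 2 - q)\<^sup>2)"
    using card_pos by (simp add: power2_eq_square)
  finally show ?thesis .
qed

section \<open>Error probability of the majority decoder\<close>

lemma forwarding_destination_received:
  assumes "i \<in> {1..K}" "forwarding_relay M (V i) (X i)" "\<omega> \<in> space M"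
  shows "Y i (t + 1) \<omega> = U t \<omega> + (Z i t \<omega> + E i (t + 1) \<omega>)"
proof -
  have "Y i (t + 1) \<omega> = X i (t + 1) \<omega> + E i (t + 1) \<omega>"
    using assms by (intro destination_received)
  \<comment> \<open>The forwarding equation holds from time 1 on, and \<open>t + 1\<close> is at
    least 1 for every \<open>t\<close>; the initial relay output never enters.\<close>
  also have "X i (t + 1) \<omega> = V i (t + 1 - 1) \<omega>"
    using assms(2,3) unfolding forwarding_relay_def by (meson le_add2)
  also have "\<dots> = U t \<omega> + Z i t \<omega>"
    using assms by (simp only: diff_add_inverse2 relay_received)
  finally show ?thesis
    by (simp only: add.assoc)
qed

lemma decoding_error_prob_majority_le:
  assumes S: "S \<subseteq> {1..K}" "S \<noteq> {}"
    and q: "\<And>i. i \<in> S \<Longrightarrow> crossover (p_s i) (p_d i) \<le> q" "q \<le> 1 / 2"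
    and forwarding: "\<And>i. i \<in> S \<Longrightarrow> forwarding_relay M (V i) (X i)"
    and W: "\<And>\<omega>. \<omega> \<in> space M \<Longrightarrow> U t \<omega> = w \<omega>"
  shows "decoding_error_prob M K w (\<lambda>i. Y i (t + 1)) (\<lambda>y. return_pmf (majority S y))
    \<le> exp (- 2 * (card S * (1 / 2 - q)\<^sup>2))"
proof -
  define B where "B = {\<omega> \<in> space M. card S \<le> 2 * card {i \<in> S. Z i t \<omega> + E i (t + 1) \<omega> = 1}}"
  have "finite S"
    using S finite_subset by blast
  have [measurable]: "(\<lambda>\<omega>. Z i t \<omega> + E i (t + 1) \<omega>) \<in> measurable M (count_space UNIV)" if "i \<in> S" for i
    using indep_vars_path_noise[OF S(1)] that by (auto simp: indep_vars_def)
  \<comment> \<open>Writing the cardinality as a finite sum of measurable terms makes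
    \<open>B\<close> visibly an event.\<close>
  have "B = {\<omega> \<in> space M. card S \<le> 2 * (\<Sum>i\<in>S. of_bool (Z i t \<omega> + E i (t + 1) \<omega> = 1))}"
    using \<open>finite S\<close> by (simp add: B_def sum.If_cases of_bool_def Int_def)
  also have "\<dots> \<in> events"
    by measurable
  finally have "B \<in> events" .
  have "decoding_error_prob M K w (\<lambda>i. Y i (t + 1)) (\<lambda>y. return_pmf (majority S y))
      \<le> expectation (indicator B)"
    unfolding decoding_error_prob_def
  \<comment> \<open>Only the dominating indicator has to be shown integrable and nonnegative: a
    non-integrable integrand would have integral 0 by convention. The decoder being deterministic,
    the integrand is 0 or 1, and it is 1 only on \<open>B\<close>.\<close>
  proof (rule integral_mono')
    fix \<omega> assume \<omega>: "\<omega> \<in> space M"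
    let ?y = "\<lambda>i\<in>{1..K}. Y i (t + 1) \<omega>"
    have "?y i = w \<omega> + (Z i t \<omega> + E i (t + 1) \<omega>)" if "i \<in> S" for i
      using that S(1) forwarding_destination_received[of i \<omega> t] forwarding W \<omega> by auto
    then have "\<omega> \<in> B" if "majority S ?y \<noteq> w \<omega>"
      using majority_wrong[OF \<open>finite S\<close> _ that, of "\<lambda>i. Z i t \<omega> + E i (t + 1) \<omega>"] \<omega>
      by (simp add: B_def)
    then show "measure_pmf.prob (return_pmf (majority S ?y)) {b. b \<noteq> w \<omega>} \<le> indicator B \<omega>"
      by (auto simp: measure_return_pmf indicator_def)
  qed (use \<open>B \<in> events\<close> in \<open>auto simp: integrable_indicator_iff less_top[symmetric]\<close>)
  also have "\<dots> = prob B"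
    using \<open>B \<in> events\<close> by simp
  also have "\<dots> \<le> exp (- 2 * (card S * (1 / 2 - q)\<^sup>2))"
    unfolding B_def using S q by (rule prob_half_path_noises_le)
  finally show ?thesis .
qed

end

section \<open>Many relays\<close>

theorem theorem5:
  fixes M :: "nat \<Rightarrow> 'a measure"
    and p_s p_d p :: "nat \<Rightarrow> nat \<Rightarrow> real"
    and W U :: "nat \<Rightarrow> nat \<Rightarrow> 'a \<Rightarrow> bit"
    and Z V X E Y :: "nat \<Rightarrow> nat \<Rightarrow> nat \<Rightarrow> 'a \<Rightarrow> bit"
    and S :: "nat \<Rightarrow> nat set"
  assumes network: "\<And>K. K \<ge> 1 \<Longrightarrow>
      bspr_network (M K) K (p_s K) (p_d K) (U K) (Z K) (V K) (X K) (E K) (Y K)"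
    and p_s_range: "\<And>K i. K \<ge> 1 \<Longrightarrow> i \<in> {1..K} \<Longrightarrow> p_s K i \<in> {0..1/2}"
    and p_d_range: "\<And>K i. K \<ge> 1 \<Longrightarrow> i \<in> {1..K} \<Longrightarrow> p_d K i \<in> {0..1/2}"
    and p_eq: "\<And>K i. K \<ge> 1 \<Longrightarrow> i \<in> {1..K} \<Longrightarrow> p K i = crossover (p_s K i) (p_d K i)"
    and uncoded: "\<And>K. K \<ge> 1 \<Longrightarrow> uncoded_transmission (M K) (W K) (U K)"
    and forwarding: "\<And>K i. K \<ge> 1 \<Longrightarrow> i \<in> {1..K} \<Longrightarrow> forwarding_relay (M K) (V K i) (X K i)"
    and S_nonempty: "\<And>K. K \<ge> 1 \<Longrightarrow> S K \<noteq> {}"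
    and S_subset: "\<And>K. K \<ge> 1 \<Longrightarrow> S K \<subseteq> {1..K}"
    and S_limit: "filterlim (\<lambda>K. real (card (S K)) * (1/2 - Max (p K ` S K))\<^sup>2) at_top sequentially"
  shows "\<forall>\<epsilon>>0. \<exists>K0\<ge>1. \<forall>K\<ge>K0. \<exists>dec. \<forall>t.
      decoding_error_prob (M K) K (W K t) (\<lambda>i. Y K i (t + 1)) dec < \<epsilon>"
proof (intro allI impI)
  fix \<epsilon> :: real
  assume "\<epsilon> > 0"
  let ?a = "\<lambda>K. real (card (S K)) * (1/2 - Max (p K ` S K))\<^sup>2"
  \<comment> \<open>The threshold solves \<open>exp (- 2 * a) = \<epsilon>\<close> for
    \<open>a\<close>.\<close>
  have "\<forall>\<^sub>F K in sequentially. ?a K > - ln \<epsilon> / 2"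
    using S_limit by (simp add: filterlim_at_top_dense)
  then obtain K1 where K1: "?a K > - ln \<epsilon> / 2" if "K \<ge> K1" for K
    by (auto simp: eventually_sequentially)
  show "\<exists>K0\<ge>1. \<forall>K\<ge>K0. \<exists>dec. \<forall>t.
      decoding_error_prob (M K) K (W K t) (\<lambda>i. Y K i (t + 1)) dec < \<epsilon>"
  \<comment> \<open>The maximum with 1 keeps \<open>K\<close> in the range where the network
    assumptions hold.\<close>
  proof (intro exI[of _ "max 1 K1"] conjI allI impI)
    fix K assume "max 1 K1 \<le> K"
    then have K: "K \<ge> 1" "K \<ge> K1"
      by auto
    interpret bspr_network "M K" K "p_s K" "p_d K" "U K" "Z K" "V K" "X K" "E K" "Y K"
      using network K(1) .
    have finite: "finite (S K)"
      using S_subset[OF K(1)] finite_subset by blast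
    have le_Max: "crossover (p_s K i) (p_d K i) \<le> Max (p K ` S K)" if "i \<in> S K" for i
    proof -
      have "p K i \<le> Max (p K ` S K)"
        using that finite by simp
      moreover have "p K i = crossover (p_s K i) (p_d K i)"
        using that S_subset[OF K(1)] p_eq[OF K(1)] by blast
      ultimately show ?thesis
        by simp
    qed
    have "p K i \<le> 1 / 2" if "i \<in> S K" for i
    proof -
      have i: "i \<in> {1..K}"
        using that S_subset[OF K(1)] by blast
      then show ?thesis
        using p_s_range[OF K(1) i] p_d_range[OF K(1) i] crossover_le_half p_eq[OF K(1) i]
        by simp
    qed
    \<comment> \<open>This fixes the sign of the gap, which the square in \<open>S_limit\<close>
      hides.\<close>
    then have Max_le: "Max (p K ` S K) \<le> 1 / 2"
      using finite S_nonempty[OF K(1)] by (subst Max_le_iff) auto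
    have "exp (- 2 * ?a K) < exp (ln \<epsilon>)"
      using K1[OF K(2)] by simp
    then have small: "exp (- 2 * ?a K) < \<epsilon>"
      using \<open>\<epsilon> > 0\<close> by simp
    \<comment> \<open>Neither the decoder nor the bound depends on \<open>t\<close>, so one rule
      serves all bits.\<close>
    have "decoding_error_prob (M K) K (W K t) (\<lambda>i. Y K i (t + 1))
        (\<lambda>y. return_pmf (majority (S K) y)) \<le> exp (- 2 * ?a K)" for t
      using S_subset[OF K(1)] S_nonempty[OF K(1)] le_Max Max_le
    proof (rule decoding_error_prob_majority_le)
      show "forwarding_relay (M K) (V K i) (X K i)" if "i \<in> S K" for i
        using that S_subset[OF K(1)] forwarding[OF K(1)] by blast
      show "U K t \<omega> = W K t \<omega>" if "\<omega> \<in> space (M K)" for \<omega>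
        using uncoded[OF K(1)] that by (simp add: uncoded_transmission_def)
    qed
    then show "\<exists>dec. \<forall>t. decoding_error_prob (M K) K (W K t) (\<lambda>i. Y K i (t + 1)) dec < \<epsilon>"
      using small order.strict_trans1 by blast
  qed simp
qed

end
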